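(* Consider the Cox model with data $(Z_i,\delta_i,X_i)$, $i=1,\dots,n$, where $X_i=(x_{i1},\dots,x_{ip})^T$, and parameters $(\lambda_1^*,\lambda_2)$; the responses are centered and the predictors are standardized. Let $\hat\beta(\lambda_1^*,\lambda_2)$ be the Adaptive Elastic Net estimator, and let $a,b\in\{1,\dots,p\}$ be such that the predictor vectors $x_a=(x_{1a},\dots,x_{na})$ and $x_b=(x_{1b},\dots,x_{nb})$ are highly correlated, in the sense of the limiting regime in which their correlation tends to $1$. Suppose that $$\hat\beta_a(\lambda_1^*,\lambda_2)\,\hat\beta_b(\lambda_1^*,\lambda_2)>0 .$$ Define $$D_{\lambda_1^*,\lambda_2}(a,b)=\bigl|\hat\beta_a(\lambda_1^*,\lambda_2)-\hat\beta_b(\lambda_1^*,\lambda_2)\bigr| .$$ Then $D_{\lambda_1^*,\lambda_2}(a,b)\to 0$ as the correlation of $x_a$ and $x_b$ tends to $1$. That is: fix $n$, $p$, the $(Z_i,\delta_i)$ and the parameters $\lambda_1,\lambda_1^*,\lambda_2,\gamma$; for every sequence of standardized covariate arrays along which $x_a x_b^T\to1$ and along which $\hat\beta_a\hat\beta_b>0$ holds for each term, $D_{\lambda_1^*,\lambda_2}(a,b)\to0$.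
   Context: Cox model: the hazard of an individual with covariate $X\in\mathbb{R}^p$ is $h(t)=h_0(t)\exp\{\beta^TX\}$, with $h_0$ a baseline hazard and $\beta=(\beta_1,\dots,\beta_p)^T$ unknown. For individual $i$, $T_i$ is the failure time, $C_i$ the censoring time, $Z_i=\min\{T_i,C_i\}$, $\delta_i=I(T_i\le C_i)$. $R_i$ is the risk set at time $t_i-0$, where $t_i$ is the time of individual $i$: the set of individuals who have not failed or been censored before that time. Standardized predictors: $\sum_{i=1}^n x_{ik}=0$ and $\sum_{i=1}^n x_{ik}^2=1$ for each $k$, so that $x_ax_b^T=\sum_i x_{ia}x_{ib}$ is the sample correlation of $x_a$ and $x_b$. Let $$\ell(\beta)=\frac1n\sum_{i=1}^n\Bigl\{-\sum_{k=1}^p\beta_kx_{ik}+\ln\Bigl[\sum_{j\in R_i}\exp\Bigl(\sum_{k=1}^p\beta_kx_{jk}\Bigr)\Bigr]\Bigr\}.$$ The Elastic Net estimator, with regularization parameters $\lambda_1,\lambda_2\ge0$, is $$\hat\beta_{(EN)}=\arg\min_{\beta}\Bigl\{\ell(\beta)+\lambda_1\sum_{k=1}^p|\beta_k|+\lambda_2\sum_{k=1}^p\beta_k^2\Bigr\}.$$ The Adaptive Elastic Net estimator, with regularization parameters $\lambda_1^*,\lambda_2\ge 0$, is $$\hat\beta(\lambda_1^*,\lambda_2)=\hat\beta_{(AEN)}=\arg\min_{\beta}\Bigl\{\ell(\beta)+\lambda_1^*\sum_{k=1}^p\hat\omega_k|\beta_k|+\lambda_2\sum_{k=1}^p\beta_k^2\Bigr\},\qquad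 \hat\omega_k=\bigl|\hat\beta_{(EN)_k}\bigr|^{-\gamma},\ \gamma>0,$$ with the convention that $\hat\beta_{(EN)_k}=0$ (infinite weight) forces $\beta_k=0$. $\hat\beta_a(\lambda_1^*,\lambda_2)$ and $\hat\beta_b(\lambda_1^*,\lambda_2)$ denote its $a$th and $b$th components.
   Formalization: The ridge parameter λ₂ is assumed strictly positive instead of λ₂ ≥ 0: at λ₂ = 0 the claim fails (e.g. λ₁ = λ₁* = λ₂ = 0, n ≥ 4, unique minimizer (2,1) while the correlation tends to 1), and the argmin may fail to exist or be unique. *)

theory Defs
  imports "HOL-Analysis.Analysis"
begin

text \<open>
  Individuals are indexed by a finite type \<open>'n\<close> and predictors by a finite type \<open>'p\<close>;
  \<open>X i $ k\<close> is the entry \<open>x_ik\<close>, so \<open>X i\<close> is the covariate vector of individual \<open>i\<close>.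
  The regularization parameters \<open>l1\<close>, \<open>l1s\<close>, \<open>l2\<close> stand for lambda_1, lambda_1^*, lambda_2.
\<close>

definition risk_set :: "('n \<Rightarrow> real) \<Rightarrow> 'n \<Rightarrow> 'n set" where
  "risk_set Z i = {j. \<not> Z j < Z i}"

definition standardized :: "('n::finite \<Rightarrow> real ^ 'p) \<Rightarrow> bool" where
  "standardized X \<longleftrightarrow> (\<forall>k. (\<Sum>i\<in>UNIV. X i $ k) = 0 \<and> (\<Sum>i\<in>UNIV. (X i $ k)\<^sup>2) = 1)"

text \<open>
  The loss sums over all individuals, censored or not; the censoring indicators
  do not enter it.
\<close>

definition cox_loss :: "('n::finite \<Rightarrow> real) \<Rightarrow> ('n \<Rightarrow> real ^ 'p) \<Rightarrow> real ^ 'p \<Rightarrow> real" where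
  "cox_loss Z X \<beta> = 1 / real CARD('n) *
     (\<Sum>i\<in>UNIV. - (\<Sum>k\<in>UNIV. \<beta> $ k * X i $ k)
        + ln (\<Sum>j\<in>risk_set Z i. exp (\<Sum>k\<in>UNIV. \<beta> $ k * X j $ k)))"

definition elastic_net ::
  "real \<Rightarrow> real \<Rightarrow> ('n::finite \<Rightarrow> real) \<Rightarrow> ('n \<Rightarrow> real ^ 'p) \<Rightarrow> real ^ 'p" where
  "elastic_net l1 l2 Z X =
     (ARG_MIN (\<lambda>\<beta>. cox_loss Z X \<beta> + l1 * (\<Sum>k\<in>UNIV. \<bar>\<beta> $ k\<bar>) + l2 * (\<Sum>k\<in>UNIV. (\<beta> $ k)\<^sup>2)) \<beta>. True)"

text \<open>
  Where the pilot estimate \<open>b\<close> vanishes the weight is infinite, which forces the coefficient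
  to be 0. That is the feasibility condition \<open>aen_feasible\<close>; since \<open>0 powr (- \<gamma>) = 0\<close>, the
  penalty term of such a coefficient then contributes nothing.
\<close>

definition aen_feasible :: "real ^ 'p \<Rightarrow> real ^ 'p \<Rightarrow> bool" where
  "aen_feasible b \<beta> \<longleftrightarrow> (\<forall>k. b $ k = 0 \<longrightarrow> \<beta> $ k = 0)"

definition adaptive_weight :: "real \<Rightarrow> real ^ 'p \<Rightarrow> 'p \<Rightarrow> real" where
  "adaptive_weight \<gamma> b k = \<bar>b $ k\<bar> powr (- \<gamma>)"

definition adaptive_elastic_net ::
  "real \<Rightarrow> real \<Rightarrow> real \<Rightarrow> real \<Rightarrow> ('n::finite \<Rightarrow> real) \<Rightarrow> ('n \<Rightarrow> real ^ 'p) \<Rightarrow> real ^ 'p" where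
  "adaptive_elastic_net \<gamma> l1 l1s l2 Z X =
     (let b = elastic_net l1 l2 Z X in
      ARG_MIN (\<lambda>\<beta>. cox_loss Z X \<beta> + l1s * (\<Sum>k\<in>UNIV. adaptive_weight \<gamma> b k * \<bar>\<beta> $ k\<bar>)
                     + l2 * (\<Sum>k\<in>UNIV. (\<beta> $ k)\<^sup>2)) \<beta>. aen_feasible b \<beta>)"

definition aen_diff ::
  "real \<Rightarrow> real \<Rightarrow> real \<Rightarrow> real \<Rightarrow> ('n::finite \<Rightarrow> real) \<Rightarrow> ('n \<Rightarrow> real ^ 'p) \<Rightarrow> 'p \<Rightarrow> 'p \<Rightarrow> real" where
  "aen_diff \<gamma> l1 l1s l2 Z X a b =
     \<bar>adaptive_elastic_net \<gamma> l1 l1s l2 Z X $ a - adaptive_elastic_net \<gamma> l1 l1s l2 Z X $ b\<bar>"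

end

theory Submission imports Defs
begin

text \<open>
  Both estimators minimise a functional \<open>loss + weighted L1 + l2 * L2\<close>. Replacing the coefficients
  at \<open>a\<close> and \<open>b\<close> by their mean lowers the ridge term by \<open>l2 * D^2 / 2\<close>, while the loss moves by at
  most \<open>D * max |x_ia - x_ib|\<close> and the L1 term rises by at most \<open>D / 2\<close> times the difference of the
  two weights. Minimality thus bounds \<open>D\<close>. For the Elastic Net the weights agree, so its
  coefficients at \<open>a\<close> and \<open>b\<close> merge. For the adaptive estimator the weights might blow up, but
  comparison with the vector whose \<open>a\<close>-th entry is deleted gives \<open>l1s * w_a <= 2\<close> whenever the
  \<open>a\<close>-th entry is nonzero. So the pilot coefficients stay away from 0, where \<open>u powr (- \<gamma>)\<close> is
  Lipschitz, and the weights merge as well.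
\<close>

text \<open>The weights \<open>c\<close> vary per coefficient so that one functional serves both
  estimators: constant \<open>l1\<close> for the pilot, \<open>l1s\<close> times the adaptive
  weights for the second stage.\<close>

definition penalized_loss ::
  "real \<Rightarrow> ('p \<Rightarrow> real) \<Rightarrow> ('n::finite \<Rightarrow> real) \<Rightarrow> ('n \<Rightarrow> real ^ 'p) \<Rightarrow> real ^ 'p \<Rightarrow> real" where
  "penalized_loss l2 c Z X \<beta> =
     cox_loss Z X \<beta> + (\<Sum>k\<in>UNIV. c k * \<bar>\<beta> $ k\<bar>) + l2 * (\<Sum>k\<in>UNIV. (\<beta> $ k)\<^sup>2)"

section \<open>Bounds for the Cox loss\<close>

lemma self_in_risk_set: "i \<in> risk_set Z i"
  by (simp add: risk_set_def)

lemma sum_exp_risk_set_pos: "0 < (\<Sum>j\<in>risk_set Z i. exp (f j :: real))"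
  for i :: "'n::finite"
  by (rule sum_pos) (use self_in_risk_set[of i Z] in auto)

text \<open>Each individual lies in its own risk set, so the logarithm dominates the linear
  term.\<close>

lemma cox_loss_nonneg: "0 \<le> cox_loss Z X \<beta>"
proof -
  have "0 \<le> - (\<Sum>k\<in>UNIV. \<beta> $ k * X i $ k)
        + ln (\<Sum>j\<in>risk_set Z i. exp (\<Sum>k\<in>UNIV. \<beta> $ k * X j $ k))" for i
  proof -
    have "exp (\<Sum>k\<in>UNIV. \<beta> $ k * X i $ k)
          \<le> (\<Sum>j\<in>risk_set Z i. exp (\<Sum>k\<in>UNIV. \<beta> $ k * X j $ k))"
      by (rule member_le_sum) (auto simp: self_in_risk_set)
    then show ?thesis
      using ln_ge_iff[OF sum_exp_risk_set_pos[where Z = Z and i = i]] by simp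
  qed
  then show ?thesis
    unfolding cox_loss_def by (intro mult_nonneg_nonneg sum_nonneg) auto
qed

lemma continuous_on_cox_loss: "continuous_on S (cox_loss Z X)"
  unfolding cox_loss_def
  by (intro continuous_intros ballI less_imp_neq[OF sum_exp_risk_set_pos, THEN not_sym])

text \<open>A shift of every linear predictor by at most \<open>e\<close> scales each risk-set sum
  by at most \<open>exp e\<close>, hence costs \<open>e\<close> in the logarithm; the linear term
  costs another \<open>e\<close>.\<close>

lemma cox_loss_le_of_predictor_close:
  fixes X :: "'n::finite \<Rightarrow> real ^ 'p::finite"
  assumes "\<And>i. \<bar>(\<Sum>k\<in>UNIV. \<beta>' $ k * X i $ k) - (\<Sum>k\<in>UNIV. \<beta> $ k * X i $ k)\<bar> \<le> e"
  shows "cox_loss Z X \<beta>' \<le> cox_loss Z X \<beta> + 2 * e"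
proof -
  define \<eta> \<eta>' where "\<eta> = (\<lambda>i. \<Sum>k\<in>UNIV. \<beta> $ k * X i $ k)"
    and "\<eta>' = (\<lambda>i. \<Sum>k\<in>UNIV. \<beta>' $ k * X i $ k)"
  have close: "\<bar>\<eta>' i - \<eta> i\<bar> \<le> e" for i
    using assms[of i] by (simp add: \<eta>_def \<eta>'_def)
  have summand: "- \<eta>' i + ln (\<Sum>j\<in>risk_set Z i. exp (\<eta>' j))
        \<le> (- \<eta> i + ln (\<Sum>j\<in>risk_set Z i. exp (\<eta> j))) + 2 * e" for i
  proof -
    have "\<eta>' j \<le> e + \<eta> j" for j
      using close[of j] by linarith
    then have "(\<Sum>j\<in>risk_set Z i. exp (\<eta>' j)) \<le> exp e * (\<Sum>j\<in>risk_set Z i. exp (\<eta> j))"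
      by (simp add: sum_distrib_left sum_mono flip: exp_add)
    then have "ln (\<Sum>j\<in>risk_set Z i. exp (\<eta>' j)) \<le> ln (exp e * (\<Sum>j\<in>risk_set Z i. exp (\<eta> j)))"
      by (simp add: sum_exp_risk_set_pos)
    also have "\<dots> = e + ln (\<Sum>j\<in>risk_set Z i. exp (\<eta> j))"
      using sum_exp_risk_set_pos[of \<eta> Z i] by (simp add: ln_mult)
    finally show ?thesis
      using close[of i] by linarith
  qed
  have "(\<Sum>i\<in>UNIV. - \<eta>' i + ln (\<Sum>j\<in>risk_set Z i. exp (\<eta>' j)))
      \<le> (\<Sum>i\<in>UNIV. (- \<eta> i + ln (\<Sum>j\<in>risk_set Z i. exp (\<eta> j))) + 2 * e)"
    by (rule sum_mono) (rule summand)
  also have "\<dots> = (\<Sum>i\<in>UNIV. - \<eta> i + ln (\<Sum>j\<in>risk_set Z i. exp (\<eta> j))) + real CARD('n) * (2 * e)"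
    by (simp add: sum.distrib)
  finally show ?thesis
    by (simp add: cox_loss_def \<eta>_def \<eta>'_def field_simps)
qed

section \<open>Existence of the minimisers\<close>

text \<open>Loss and L1 term are nonnegative, so the ridge term makes the functional coercive, and
  compactness of a ball suffices.\<close>

lemma penalized_loss_has_min:
  fixes X :: "'n::finite \<Rightarrow> real ^ 'p::finite"
  assumes l2: "0 < l2" and c: "\<And>k. 0 \<le> c k" and closed: "closed {\<beta>. P \<beta>}" and P0: "P 0"
  shows "\<exists>\<beta>. is_arg_min (penalized_loss l2 c Z X) P \<beta>"
proof -
  let ?F = "penalized_loss l2 c Z X"
  \<comment> \<open>Chosen so that \<open>l2 * r^2\<close> is the value at 0: no point outside the
    ball of radius \<open>r\<close> beats 0.\<close>
  define r where "r = sqrt (?F 0 / l2)"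
  have lower: "l2 * (norm \<beta>)\<^sup>2 \<le> ?F \<beta>" for \<beta>
    using cox_loss_nonneg[of Z X \<beta>] c
    by (simp add: penalized_loss_def norm_vec_def L2_set_def sum_nonneg)
  have F0: "0 \<le> ?F 0"
    using lower[of 0] by simp
  have "compact ({\<beta>. P \<beta>} \<inter> cball 0 r)"
    using closed by (simp add: closed_Int_compact)
  moreover have "{\<beta>. P \<beta>} \<inter> cball 0 r \<noteq> {}"
  proof -
    have "0 \<in> {\<beta>. P \<beta>} \<inter> cball 0 r"
      using P0 F0 l2 by (simp add: r_def)
    then show ?thesis
      by blast
  qed
  moreover have "continuous_on ({\<beta>. P \<beta>} \<inter> cball 0 r) ?F"
    unfolding penalized_loss_def by (intro continuous_intros continuous_on_cox_loss)
  ultimately have "\<exists>\<beta>\<in>{\<beta>. P \<beta>} \<inter> cball 0 r. \<forall>\<beta>'\<in>{\<beta>. P \<beta>} \<inter> cball 0 r. ?F \<beta> \<le> ?F \<beta>'"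
    by (rule continuous_attains_inf)
  then obtain \<beta> where \<beta>: "P \<beta>" "\<And>\<beta>'. P \<beta>' \<Longrightarrow> norm \<beta>' \<le> r \<Longrightarrow> ?F \<beta> \<le> ?F \<beta>'"
    by auto
  have "?F \<beta> \<le> ?F \<beta>'" if "P \<beta>'" for \<beta>'
  proof (cases "norm \<beta>' \<le> r")
    case False
    have "0 \<le> r"
      using F0 l2 by (simp add: r_def)
    with False have "r\<^sup>2 \<le> (norm \<beta>')\<^sup>2"
      by (intro power_mono) auto
    then have "?F 0 \<le> l2 * (norm \<beta>')\<^sup>2"
      using F0 l2 by (simp add: r_def field_simps)
    moreover have "?F \<beta> \<le> ?F 0"
      using \<beta>(2)[OF P0] \<open>0 \<le> r\<close> by simp
    ultimately show ?thesis
      using lower[of \<beta>'] by linarith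
  qed (use \<beta> that in auto)
  with \<beta>(1) show ?thesis
    by (auto simp: is_arg_min_linorder)
qed

text \<open>\<open>ARG_MIN\<close> is a Hilbert choice, so it is a minimiser only once existence is
  known.\<close>

lemma is_arg_min_elastic_net:
  assumes "0 \<le> l1" "0 < l2"
  shows "is_arg_min (penalized_loss l2 (\<lambda>_. l1) Z X) (\<lambda>_. True) (elastic_net l1 l2 Z X)"
proof -
  have "elastic_net l1 l2 Z X = arg_min (penalized_loss l2 (\<lambda>_. l1) Z X) (\<lambda>_. True)"
    unfolding elastic_net_def penalized_loss_def by (simp add: sum_distrib_left)
  then show ?thesis
    using penalized_loss_has_min[of l2 "\<lambda>_. l1" "\<lambda>_. True" Z X] assms
    unfolding arg_min_def by (auto intro: someI_ex)
qed

lemma is_arg_min_adaptive_elastic_net: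
  assumes "0 \<le> l1s" "0 < l2"
  shows "is_arg_min (penalized_loss l2 (\<lambda>k. l1s * adaptive_weight \<gamma> (elastic_net l1 l2 Z X) k) Z X)
           (aen_feasible (elastic_net l1 l2 Z X)) (adaptive_elastic_net \<gamma> l1 l1s l2 Z X)"
proof -
  let ?b = "elastic_net l1 l2 Z X"
  let ?c = "\<lambda>k. l1s * adaptive_weight \<gamma> ?b k"
  \<comment> \<open>The feasible set is an intersection of coordinate hyperplanes, hence
    closed.\<close>
  have "{\<beta>. aen_feasible ?b \<beta>} = (\<Inter>k\<in>{k. ?b $ k = 0}. {\<beta>. \<beta> $ k = 0})"
    by (auto simp: aen_feasible_def)
  also have "closed \<dots>"
    by (intro closed_INT ballI closed_Collect_eq continuous_intros)
  finally have closed: "closed {\<beta>. aen_feasible ?b \<beta>}" .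
  have "adaptive_elastic_net \<gamma> l1 l1s l2 Z X = arg_min (penalized_loss l2 ?c Z X) (aen_feasible ?b)"
    unfolding adaptive_elastic_net_def penalized_loss_def
    by (simp add: sum_distrib_left mult.assoc Let_def)
  moreover have "\<exists>\<beta>. is_arg_min (penalized_loss l2 ?c Z X) (aen_feasible ?b) \<beta>"
    by (rule penalized_loss_has_min)
      (use assms closed in \<open>auto simp: adaptive_weight_def aen_feasible_def\<close>)
  ultimately show ?thesis
    unfolding arg_min_def by (auto intro: someI_ex)
qed

section \<open>Comparison inequalities for minimisers\<close>

lemma penalized_min_coeffs_close:
  fixes X :: "'n::finite \<Rightarrow> real ^ 'p::finite"
  assumes min: "is_arg_min (penalized_loss l2 c Z X) P \<beta>"
    and P: "P (\<chi> k. if k = a \<or> k = b then (\<beta> $ a + \<beta> $ b) / 2 else \<beta> $ k)"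
    and c: "\<And>k. 0 \<le> c k"
    and close: "\<And>i. \<bar>X i $ a - X i $ b\<bar> \<le> e"
  shows "l2 * \<bar>\<beta> $ a - \<beta> $ b\<bar> \<le> 2 * e + \<bar>c a - c b\<bar>"
proof (cases "\<beta> $ a = \<beta> $ b")
  case True
  then show ?thesis
    \<comment> \<open>Any index will do: \<open>close\<close> yields
      \<open>0 \<le> e\<close>.\<close>
    using close[of undefined] by simp
next
  case False
  define m where "m = (\<beta> $ a + \<beta> $ b) / 2"
  define D where "D = \<bar>\<beta> $ a - \<beta> $ b\<bar>"
  define \<beta>' where "\<beta>' = (\<chi> k. if k = a \<or> k = b then m else \<beta> $ k)"
  have "a \<noteq> b" and D: "0 < D"
    using False by (auto simp: D_def)
  have split: "(\<Sum>k\<in>UNIV. f k) = f a + f b + (\<Sum>k\<in>UNIV - {a, b}. f k)" for f :: "'p \<Rightarrow> real"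
    using sum.subset_diff[of "{a, b}" UNIV f] \<open>a \<noteq> b\<close> by (simp add: add.commute)
  have \<beta>'_simps: "\<beta>' $ a = m" "\<beta>' $ b = m" "k \<noteq> a \<Longrightarrow> k \<noteq> b \<Longrightarrow> \<beta>' $ k = \<beta> $ k" for k
    by (auto simp: \<beta>'_def)
  have rest: "(\<Sum>k\<in>UNIV - {a, b}. f k (\<beta>' $ k)) = (\<Sum>k\<in>UNIV - {a, b}. f k (\<beta> $ k))"
    for f :: "'p \<Rightarrow> real \<Rightarrow> real"
    by (rule sum.cong) (auto simp: \<beta>'_simps)
  have "\<bar>(\<Sum>k\<in>UNIV. \<beta>' $ k * X i $ k) - (\<Sum>k\<in>UNIV. \<beta> $ k * X i $ k)\<bar> \<le> D / 2 * e" for i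
  proof -
    \<comment> \<open>The entries at \<open>a\<close> and \<open>b\<close> move by opposite amounts,
      so only the difference of the two predictors survives.\<close>
    have "(\<Sum>k\<in>UNIV. \<beta>' $ k * X i $ k) - (\<Sum>k\<in>UNIV. \<beta> $ k * X i $ k)
        = (\<beta> $ b - \<beta> $ a) / 2 * (X i $ a - X i $ b)"
      unfolding split rest[of "\<lambda>k u. u * X i $ k"] \<beta>'_simps m_def by (simp add: field_simps)
    also have "\<bar>\<dots>\<bar> = D / 2 * \<bar>X i $ a - X i $ b\<bar>"
      by (simp add: abs_mult D_def abs_minus_commute)
    also have "\<dots> \<le> D / 2 * e"
      using close D by (intro mult_left_mono) auto
    finally show ?thesis .
  qed
  then have loss: "cox_loss Z X \<beta>' \<le> cox_loss Z X \<beta> + D * e"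
    using cox_loss_le_of_predictor_close[of \<beta>' X \<beta> "D / 2 * e" Z] by simp
  have ridge: "(\<Sum>k\<in>UNIV. (\<beta>' $ k)\<^sup>2) = (\<Sum>k\<in>UNIV. (\<beta> $ k)\<^sup>2) - D\<^sup>2 / 2"
    unfolding split rest[of "\<lambda>k u. u\<^sup>2"] \<beta>'_simps
    by (simp add: m_def D_def power2_eq_square field_simps)
  \<comment> \<open>The L1 terms at \<open>a\<close> and \<open>b\<close> split into a part with the
    mean weight, which averaging cannot raise by convexity, and a part carrying half the weight
    difference.\<close>
  have lasso: "(\<Sum>k\<in>UNIV. c k * \<bar>\<beta>' $ k\<bar>) \<le> (\<Sum>k\<in>UNIV. c k * \<bar>\<beta> $ k\<bar>) + \<bar>c a - c b\<bar> * D / 2"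
  proof -
    have "(c a + c b) / 2 * (2 * \<bar>m\<bar>) \<le> (c a + c b) / 2 * (\<bar>\<beta> $ a\<bar> + \<bar>\<beta> $ b\<bar>)"
      using c by (intro mult_left_mono) (auto simp: m_def)
    moreover have "(c a - c b) / 2 * (\<bar>\<beta> $ b\<bar> - \<bar>\<beta> $ a\<bar>) \<le> \<bar>c a - c b\<bar> / 2 * D"
    proof -
      have "\<bar>(c a - c b) / 2\<bar> * \<bar>\<bar>\<beta> $ b\<bar> - \<bar>\<beta> $ a\<bar>\<bar> \<le> \<bar>(c a - c b) / 2\<bar> * D"
        by (intro mult_left_mono) (auto simp: D_def)
      then show ?thesis
        by (simp flip: abs_mult)
    qed
    ultimately show ?thesis
      unfolding split rest[of "\<lambda>k u. c k * \<bar>u\<bar>"] \<beta>'_simps by (simp add: field_simps)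
  qed
  have "penalized_loss l2 c Z X \<beta> \<le> penalized_loss l2 c Z X \<beta>'"
    using min P unfolding \<beta>'_def m_def by (simp add: is_arg_min_linorder)
  \<comment> \<open>The ridge gain \<open>l2 * D^2 / 2\<close> is at most the loss and L1 costs; the
    inequality is doubled so that \<open>D\<close> can be cancelled.\<close>
  then have "D * (l2 * D) \<le> D * (2 * e + \<bar>c a - c b\<bar>)"
    using loss lasso unfolding penalized_loss_def ridge
    by (simp add: power2_eq_square algebra_simps)
  then show ?thesis
    using D by (simp add: D_def)
qed

text \<open>Deleting entry \<open>a\<close> saves its penalty and costs at most \<open>2 * M\<close>
  times its modulus in loss; cancelling that modulus caps the weight.\<close>

lemma penalized_min_weight_bound:
  fixes X :: "'n::finite \<Rightarrow> real ^ 'p::finite"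
  assumes min: "is_arg_min (penalized_loss l2 c Z X) P \<beta>"
    and P: "P (\<chi> k. if k = a then 0 else \<beta> $ k)"
    and "0 \<le> l2" and nonzero: "\<beta> $ a \<noteq> 0"
    and bound: "\<And>i. \<bar>X i $ a\<bar> \<le> M"
  shows "c a \<le> 2 * M"
proof -
  define \<beta>' where "\<beta>' = (\<chi> k. if k = a then 0 else \<beta> $ k)"
  have rest: "(\<Sum>k\<in>UNIV. f k (\<beta>' $ k)) = (\<Sum>k\<in>UNIV. f k (\<beta> $ k)) - f a (\<beta> $ a)"
    if "f a 0 = 0" for f :: "'p \<Rightarrow> real \<Rightarrow> real"
    using that sum.remove[of UNIV a "\<lambda>k. f k (\<beta> $ k)"] sum.remove[of UNIV a "\<lambda>k. f k (\<beta>' $ k)"]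
    by (simp add: \<beta>'_def)
  have "\<bar>(\<Sum>k\<in>UNIV. \<beta>' $ k * X i $ k) - (\<Sum>k\<in>UNIV. \<beta> $ k * X i $ k)\<bar> \<le> \<bar>\<beta> $ a\<bar> * M" for i
    using rest[of "\<lambda>k u. u * X i $ k"] bound[of i] by (simp add: abs_mult mult_left_mono)
  then have loss: "cox_loss Z X \<beta>' \<le> cox_loss Z X \<beta> + 2 * (\<bar>\<beta> $ a\<bar> * M)"
    by (rule cox_loss_le_of_predictor_close)
  have "penalized_loss l2 c Z X \<beta> \<le> penalized_loss l2 c Z X \<beta>'"
    using min P by (simp add: is_arg_min_linorder \<beta>'_def)
  then have "c a * \<bar>\<beta> $ a\<bar> + l2 * (\<beta> $ a)\<^sup>2 \<le> 2 * (\<bar>\<beta> $ a\<bar> * M)"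
    using loss rest[of "\<lambda>k u. c k * \<bar>u\<bar>"] rest[of "\<lambda>k u. u\<^sup>2"]
    by (simp add: penalized_loss_def algebra_simps)
  moreover have "0 \<le> l2 * (\<beta> $ a)\<^sup>2"
    using \<open>0 \<le> l2\<close> by simp
  ultimately have "\<bar>\<beta> $ a\<bar> * c a \<le> \<bar>\<beta> $ a\<bar> * (2 * M)"
    by (simp add: algebra_simps)
  then show ?thesis
    using nonzero by (simp add: mult_le_cancel_left)
qed

text \<open>Mean value bound on \<open>{r..}\<close>, where the modulus of the derivative is largest
  at \<open>r\<close>.\<close>

lemma abs_powr_minus_diff_le:
  fixes u v r \<gamma> :: real
  assumes "0 < r" "r \<le> u" "r \<le> v" "0 < \<gamma>"
  shows "\<bar>u powr (- \<gamma>) - v powr (- \<gamma>)\<bar> \<le> \<gamma> * r powr (- \<gamma> - 1) * \<bar>u - v\<bar>"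
proof -
  have "norm (u powr (- \<gamma>) - v powr (- \<gamma>)) \<le> \<gamma> * r powr (- \<gamma> - 1) * norm (u - v)"
  proof (rule field_differentiable_bound)
    fix t assume t: "t \<in> {r..}"
    then show "((\<lambda>t. t powr (- \<gamma>)) has_field_derivative - \<gamma> * t powr (- \<gamma> - 1)) (at t within {r..})"
      using \<open>0 < r\<close> by (auto intro!: derivative_eq_intros)
    show "norm (- \<gamma> * t powr (- \<gamma> - 1)) \<le> \<gamma> * r powr (- \<gamma> - 1)"
      using t assms by (auto simp: abs_mult intro: powr_mono2')
  qed (use assms in auto)
  then show ?thesis
    by simp
qed

lemma standardized_abs_le_1:
  assumes "standardized X"
  shows "\<bar>X i $ k\<bar> \<le> 1"
proof -
  have "(X i $ k)\<^sup>2 \<le> (\<Sum>i\<in>UNIV. (X i $ k)\<^sup>2)"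
    by (rule member_le_sum) auto
  then show ?thesis
    using assms by (simp add: standardized_def abs_square_le_1)
qed

text \<open>Turns correlation into entrywise closeness: the squared distance of two unit vectors is
  2 minus twice their inner product.\<close>

lemma standardized_diff_le:
  assumes "standardized X"
  shows "\<bar>X i $ a - X i $ b\<bar> \<le> sqrt (2 - 2 * (\<Sum>i\<in>UNIV. X i $ a * X i $ b))"
proof -
  have "(X i $ a - X i $ b)\<^sup>2 \<le> (\<Sum>i\<in>UNIV. (X i $ a - X i $ b)\<^sup>2)"
    by (rule member_le_sum) auto
  also have "\<dots> = 2 - 2 * (\<Sum>i\<in>UNIV. X i $ a * X i $ b)"
    using assms
    by (simp add: standardized_def power2_diff sum.distrib sum_subtractf mult.assoc
        flip: sum_distrib_left)
  finally show ?thesis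
    using real_le_rsqrt by (metis power2_abs)
qed

section \<open>Quantitative bound and limit\<close>

text \<open>\<open>K\<close> depends on the parameters only, not on \<open>X\<close>, so the bound
  is uniform along a sequence of covariate arrays. Its first summand comes from the loss, its second
  from the gap between the adaptive weights.\<close>

lemma adaptive_elastic_net_coeffs_close:
  fixes X :: "'n::finite \<Rightarrow> real ^ 'p::finite" and \<gamma> l1 l1s l2 :: real
  defines "K \<equiv> 2 / l2 + 2 * l1s * \<gamma> * ((l1s / 2) powr (1 / \<gamma>)) powr (- \<gamma> - 1) / l2\<^sup>2"
  assumes "0 \<le> l1" "0 \<le> l1s" "0 < l2" "0 < \<gamma>" "standardized X"
    and nonzero: "adaptive_elastic_net \<gamma> l1 l1s l2 Z X $ a \<noteq> 0"
      "adaptive_elastic_net \<gamma> l1 l1s l2 Z X $ b \<noteq> 0"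
  shows "aen_diff \<gamma> l1 l1s l2 Z X a b \<le> K * sqrt (2 - 2 * (\<Sum>i\<in>UNIV. X i $ a * X i $ b))"
proof -
  define e where "e = sqrt (2 - 2 * (\<Sum>i\<in>UNIV. X i $ a * X i $ b))"
  define u where "u = elastic_net l1 l2 Z X"
  define \<beta> where "\<beta> = adaptive_elastic_net \<gamma> l1 l1s l2 Z X"
  define w where "w = adaptive_weight \<gamma> u"
  \<comment> \<open>Solves \<open>l1s * r powr (- \<gamma>) = 2\<close> for positive
    \<open>l1s\<close>: the least modulus the weight bound allows a pilot coefficient.\<close>
  define r where "r = (l1s / 2) powr (1 / \<gamma>)"
  define L where "L = \<gamma> * r powr (- \<gamma> - 1)"
  have close: "\<bar>X i $ a - X i $ b\<bar> \<le> e" for i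
    unfolding e_def by (rule standardized_diff_le) fact
  have "l2 * \<bar>u $ a - u $ b\<bar> \<le> 2 * e + \<bar>l1 - l1\<bar>"
    unfolding u_def
    by (rule penalized_min_coeffs_close[OF is_arg_min_elastic_net]) (use close assms in auto)
  then have u_close: "l2 * \<bar>u $ a - u $ b\<bar> \<le> 2 * e"
    by simp
  have min: "is_arg_min (penalized_loss l2 (\<lambda>k. l1s * w k) Z X) (aen_feasible u) \<beta>"
    unfolding w_def u_def \<beta>_def by (rule is_arg_min_adaptive_elastic_net) fact+
  then have feasible: "aen_feasible u \<beta>"
    by (simp add: is_arg_min_def)
  \<comment> \<open>Hence the constraint leaves the entries at \<open>a\<close> and \<open>b\<close>
    free, and the averaged vector stays feasible.\<close>
  have u_nonzero: "u $ a \<noteq> 0" "u $ b \<noteq> 0"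
    using feasible nonzero by (auto simp: aen_feasible_def \<beta>_def)
  have "l2 * \<bar>\<beta> $ a - \<beta> $ b\<bar> \<le> 2 * e + \<bar>l1s * w a - l1s * w b\<bar>"
    by (rule penalized_min_coeffs_close[OF min])
      (use feasible u_nonzero close \<open>0 \<le> l1s\<close> in \<open>auto simp: aen_feasible_def w_def adaptive_weight_def\<close>)
  also have "\<bar>l1s * w a - l1s * w b\<bar> = l1s * \<bar>w a - w b\<bar>"
    using \<open>0 \<le> l1s\<close> by (simp add: abs_mult flip: right_diff_distrib)
  also have "\<dots> \<le> l1s * (L * (2 * e / l2))"
  \<comment> \<open>For \<open>l1s = 0\<close> the radius \<open>r\<close> degenerates to 0, but
    then both sides vanish.\<close>
  proof (cases "l1s = 0")
    case False
    with \<open>0 \<le> l1s\<close> have "0 < l1s"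
      by simp
    have r: "r \<le> \<bar>u $ k\<bar>" if "u $ k \<noteq> 0" "\<beta> $ k \<noteq> 0" for k
    proof -
      have "l1s * w k \<le> 2 * 1"
        by (rule penalized_min_weight_bound[OF min])
          (use feasible that \<open>0 < l2\<close> standardized_abs_le_1[OF \<open>standardized X\<close>]
            in \<open>auto simp: aen_feasible_def\<close>)
      then have "l1s / 2 \<le> \<bar>u $ k\<bar> powr \<gamma>"
        using that(1) by (simp add: w_def adaptive_weight_def powr_minus field_simps)
      then have "r \<le> (\<bar>u $ k\<bar> powr \<gamma>) powr (1 / \<gamma>)"
        unfolding r_def using \<open>0 < l1s\<close> \<open>0 < \<gamma>\<close> by (intro powr_mono2) auto
      then show ?thesis
        using \<open>0 < \<gamma>\<close> by (simp add: powr_powr)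
    qed
    have "0 < r"
      using \<open>0 < l1s\<close> by (simp add: r_def)
    then have "\<bar>w a - w b\<bar> \<le> L * \<bar>\<bar>u $ a\<bar> - \<bar>u $ b\<bar>\<bar>"
      unfolding w_def adaptive_weight_def L_def
      by (intro abs_powr_minus_diff_le r u_nonzero nonzero[folded \<beta>_def] \<open>0 < \<gamma>\<close>)
    also have "\<dots> \<le> L * (2 * e / l2)"
    proof (rule mult_left_mono)
      have "\<bar>\<bar>u $ a\<bar> - \<bar>u $ b\<bar>\<bar> \<le> \<bar>u $ a - u $ b\<bar>"
        by simp
      also have "\<dots> \<le> 2 * e / l2"
        using u_close \<open>0 < l2\<close> by (simp add: field_simps)
      finally show "\<bar>\<bar>u $ a\<bar> - \<bar>u $ b\<bar>\<bar> \<le> 2 * e / l2" .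
      show "0 \<le> L"
        using \<open>0 < \<gamma>\<close> by (simp add: L_def)
    qed
    finally show ?thesis
      using \<open>0 \<le> l1s\<close> by (rule mult_left_mono)
  qed simp
  finally have "\<bar>\<beta> $ a - \<beta> $ b\<bar> \<le> (2 * e + l1s * (L * (2 * e / l2))) / l2"
    using \<open>0 < l2\<close> by (simp add: field_simps)
  also have "\<dots> = K * e"
    using \<open>0 < l2\<close> by (simp add: K_def L_def r_def power2_eq_square field_simps)
  finally show ?thesis
    by (simp add: aen_diff_def \<beta>_def e_def)
qed

theorem theorem3p1:
  fixes T C Z :: "'n::finite \<Rightarrow> real" and \<delta> :: "'n \<Rightarrow> nat"
    and l1 l1s l2 \<gamma> :: real
    and X :: "nat \<Rightarrow> 'n \<Rightarrow> real ^ 'p::finite"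
    and a b :: 'p
  assumes "\<And>i. Z i = min (T i) (C i)"
    and "\<And>i. \<delta> i = of_bool (T i \<le> C i)"
    and "(\<Sum>i\<in>UNIV. Z i) = 0"
    and "0 \<le> l1" and "0 \<le> l1s" and "0 < l2" and "0 < \<gamma>"
    and "\<And>m. standardized (X m)"
    and "(\<lambda>m. \<Sum>i\<in>UNIV. X m i $ a * X m i $ b) \<longlonglongrightarrow> 1"
    and "\<And>m. adaptive_elastic_net \<gamma> l1 l1s l2 Z (X m) $ a
              * adaptive_elastic_net \<gamma> l1 l1s l2 Z (X m) $ b > 0"
  shows "(\<lambda>m. aen_diff \<gamma> l1 l1s l2 Z (X m) a b) \<longlonglongrightarrow> 0"
proof -
  let ?\<rho> = "\<lambda>m. \<Sum>i\<in>UNIV. X m i $ a * X m i $ b"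
  let ?K = "2 / l2 + 2 * l1s * \<gamma> * ((l1s / 2) powr (1 / \<gamma>)) powr (- \<gamma> - 1) / l2\<^sup>2"
  have "(\<lambda>m. ?K * sqrt (2 - 2 * ?\<rho> m)) \<longlonglongrightarrow> ?K * sqrt (2 - 2 * 1)"
    by (intro tendsto_intros assms(9))
  then have lim: "(\<lambda>m. ?K * sqrt (2 - 2 * ?\<rho> m)) \<longlonglongrightarrow> 0"
    by simp
  \<comment> \<open>The positive product makes both coefficients nonzero, as the uniform bound
    requires.\<close>
  have "aen_diff \<gamma> l1 l1s l2 Z (X m) a b \<le> ?K * sqrt (2 - 2 * ?\<rho> m)" for m
    using assms(10)[of m] by (intro adaptive_elastic_net_coeffs_close assms) auto
  then show ?thesis
    by (intro tendsto_sandwich[OF _ _ tendsto_const lim] always_eventually)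
      (auto simp: aen_diff_def)
qed

end
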